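(* Let $K$ be a zero-dimensional compact Hausdorff space whose set of isolated points is dense in $K$. Then every non-expansive homeomorphism $F:B_{C(K)}\to B_{C(K)}$ is an isometry.
   Context: $C(K)$ denotes the Banach space of real-valued continuous functions on $K$ with the supremum norm, and $B_{C(K)}$ its closed unit ball. A topological space is zero-dimensional if it has a basis consisting of clopen sets. A map is non-expansive if it is $1$-Lipschitz. *)

theory Defs
  imports "HOL-Analysis.Analysis"
begin

definition zero_dimensional :: "'a topology \<Rightarrow> bool" where
  "zero_dimensional X \<longleftrightarrow>
     (\<forall>U x. openin X U \<and> x \<in> U \<longrightarrow>
        (\<exists>V. openin X V \<and> closedin X V \<and> x \<in> V \<and> V \<subseteq> U))"

end

theory Submission
  imports Defs
begin

text \<open>
  Let \<open>G\<close> be the inverse of \<open>F\<close>. Intersections of unit balls centred at \<open>\<plusminus>1\<close>-valued functions show that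
  \<open>G\<close> maps such functions to such functions, commutes with negation, and turns the flip of one value
  at an isolated point \<open>d\<close> into the flip of one value at an isolated point \<open>p d\<close>; by injectivity of
  \<open>F\<close> on rays, \<open>p d\<close> depends on \<open>d\<close> only, so that \<open>G u (p d) = \<eta> d * u d\<close> for every
  \<open>\<plusminus>1\<close>-valued \<open>u\<close>, and every isolated point is some \<open>p d\<close>.

  Normalise to \<open>F 1 = 1\<close>. Comparing \<open>f \<ge> 0\<close> with \<open>1\<close> flipped at \<open>p d\<close> gives \<open>0 \<le> F f d \<le> f (p d)\<close>.
  Hence \<open>G w \<ge> 0\<close> propagates along the segment from \<open>1\<close> to a strictly positive \<open>w\<close>; this is where
  continuity of \<open>G\<close> enters. For strictly positive \<open>w\<close> with finitely many values, induction on the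
  number of values below \<open>w d\<close> then yields \<open>G w (p d) = w d\<close>. Such functions, multiplied by
  \<open>\<plusminus>1\<close>-valued ones, are dense, so \<open>G w (p d) = \<eta> d * w d\<close> for all \<open>w\<close>, and \<open>F\<close> is isometric.
\<close>

section \<open>The unit ball on plain functions, sign functions, and gluing along clopen
  sets\<close>

definition unit_ball :: "('a::topological_space \<Rightarrow> real) set" where
  "unit_ball = {f. continuous_on UNIV f \<and> (\<forall>t. \<bar>f t\<bar> \<le> 1)}"

text \<open>These are the extreme points of \<open>unit_ball\<close>.\<close>

definition sign_functions :: "('a::topological_space \<Rightarrow> real) set" where
  "sign_functions = {f. continuous_on UNIV f \<and> (\<forall>t. f t = 1 \<or> f t = -1)}"

lemma sign_functions_subset: "u \<in> sign_functions \<Longrightarrow> u \<in> unit_ball"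
proof -
  assume "u \<in> sign_functions"
  then have "continuous_on UNIV u" "u t = 1 \<or> u t = -1" for t by (auto simp: sign_functions_def)
  then have "continuous_on UNIV u" "\<bar>u t\<bar> \<le> 1" for t by (simp, smt (verit))
  then show ?thesis by (simp add: unit_ball_def)
qed

lemma sign_functionsD: "u \<in> sign_functions \<Longrightarrow> u t = 1 \<or> u t = -1"
  by (auto simp: sign_functions_def)

lemma sign_functions_uminus: "u \<in> sign_functions \<Longrightarrow> (\<lambda>t. - u t) \<in> sign_functions"
  unfolding sign_functions_def
  by (auto intro!: continuous_on_minus)

lemma unit_ballI: "continuous_on UNIV f \<Longrightarrow> (\<And>t. \<bar>f t\<bar> \<le> 1) \<Longrightarrow> f \<in> unit_ball"
  by (simp add: unit_ball_def)

lemma unit_ballD: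
  assumes "f \<in> unit_ball"
  shows "continuous_on UNIV f" "\<bar>f t\<bar> \<le> 1"
  using assms by (auto simp: unit_ball_def)

lemma unit_ball_const: "\<bar>c\<bar> \<le> 1 \<Longrightarrow> (\<lambda>_. c) \<in> unit_ball"
  by (simp add: unit_ball_def)

lemma unit_ball_mult:
  assumes "f \<in> unit_ball" "g \<in> unit_ball"
  shows "(\<lambda>t. f t * g t) \<in> unit_ball"
  using assms unfolding unit_ball_def
  by (auto intro!: continuous_intros simp: abs_mult mult_le_one)

lemma continuous_on_if_clopen:
  fixes f g :: "'a::topological_space \<Rightarrow> 'b::topological_space"
  assumes "open V" "closed V" "continuous_on UNIV f" "continuous_on UNIV g"
  shows "continuous_on UNIV (\<lambda>t. if t \<in> V then f t else g t)"
proof -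
  have "continuous_on (V \<union> -V) (\<lambda>t. if t \<in> V then f t else g t)"
    by (rule continuous_on_cases)
      (use assms in \<open>auto intro: continuous_on_subset simp: closed_def\<close>)
  then show ?thesis by simp
qed

lemma continuous_on_fun_upd_isolated:
  fixes f :: "'a::t1_space \<Rightarrow> 'b::topological_space"
  assumes "open {d}" "continuous_on UNIV f"
  shows "continuous_on UNIV (f(d := c))"
proof -
  have "f(d := c) = (\<lambda>t. if t \<in> {d} then c else f t)" by auto
  then show ?thesis
    using continuous_on_if_clopen[of "{d}" "\<lambda>_. c" f] assms by simp
qed

text \<open>Every subset of a finite range is closed in a T1 space, so \<open>h\<close> may jump.
  This yields continuity of signs and truncations of functions with finitely many values.\<close>

lemma continuous_on_comp_finite_range:
  fixes g :: "'a::topological_space \<Rightarrow> 'b::t1_space" and h :: "'b \<Rightarrow> 'c::topological_space"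
  assumes "continuous_on UNIV g" "finite (range g)"
  shows "continuous_on UNIV (\<lambda>t. h (g t))"
proof -
  have "closed ((\<lambda>t. h (g t)) -` S)" for S
  proof -
    have "(\<lambda>t. h (g t)) -` S = g -` (range g \<inter> h -` S)" by auto
    moreover have "closed (range g \<inter> h -` S)"
      using assms(2) by (intro finite_imp_closed) auto
    ultimately show ?thesis
      using assms(1) by (simp add: continuous_on_closed_vimage del: vimage_Int)
  qed
  then show ?thesis by (simp add: continuous_on_closed_vimage)
qed

lemma dense_imp_le:
  fixes f :: "'a::topological_space \<Rightarrow> real"
  assumes "closure D = UNIV" "continuous_on UNIV f" "\<And>d. d \<in> D \<Longrightarrow> f d \<le> c"
  shows "f t \<le> c"
proof -
  have "closed {t. f t \<le> c}"
    using assms(2) by (intro closed_Collect_le continuous_on_const)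
  then have "closure D \<subseteq> {t. f t \<le> c}"
    using assms(3) by (intro closure_minimal) auto
  then show ?thesis using assms(1) by auto
qed

text \<open>Working with plain functions and pointwise bounds \<open>r\<close> in place of norms
  makes definitions by cases direct; all assumptions on the maps are restricted to
  \<open>unit_ball\<close>. \<open>G_continuous\<close> is sup-norm continuity of the
  inverse.\<close>

locale nonexpansive_homeo =
  fixes F G :: "('a::t2_space \<Rightarrow> real) \<Rightarrow> 'a \<Rightarrow> real"
  assumes compact_space: "compact (UNIV :: 'a set)"
    and clopen_basis: "\<And>U (x::'a). open U \<Longrightarrow> x \<in> U \<Longrightarrow> \<exists>V. open V \<and> closed V \<and> x \<in> V \<and> V \<subseteq> U"
    and dense_isolated: "closure {d::'a. open {d}} = UNIV"
    and F_ball: "f \<in> unit_ball \<Longrightarrow> F f \<in> unit_ball"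
    and G_ball: "f \<in> unit_ball \<Longrightarrow> G f \<in> unit_ball"
    and GF: "f \<in> unit_ball \<Longrightarrow> G (F f) = f"
    and FG: "f \<in> unit_ball \<Longrightarrow> F (G f) = f"
    and nonexpansive: "f \<in> unit_ball \<Longrightarrow> g \<in> unit_ball \<Longrightarrow> (\<And>t. \<bar>f t - g t\<bar> \<le> r) \<Longrightarrow> \<bar>F f t - F g t\<bar> \<le> r"
    and G_continuous: "f \<in> unit_ball \<Longrightarrow> 0 < e \<Longrightarrow>
      \<exists>\<delta>>0. \<forall>g\<in>unit_ball. (\<forall>t. \<bar>f t - g t\<bar> \<le> \<delta>) \<longrightarrow> (\<forall>t. \<bar>G f t - G g t\<bar> \<le> e)"
begin

abbreviation D :: "'a set" where "D \<equiv> {d. open {d}}"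

section \<open>Metric consequences and the action of \<open>G\<close> on sign functions\<close>

lemma G_expansive:
  assumes "f \<in> unit_ball" "g \<in> unit_ball" "\<And>t. \<bar>G f t - G g t\<bar> \<le> r"
  shows "\<bar>f t - g t\<bar> \<le> r"
  using nonexpansive[of "G f" "G g" r t] assms by (simp add: G_ball FG)

lemma F_inject: "f \<in> unit_ball \<Longrightarrow> g \<in> unit_ball \<Longrightarrow> F f = F g \<Longrightarrow> f = g"
  by (metis GF)

lemma G_inject: "f \<in> unit_ball \<Longrightarrow> g \<in> unit_ball \<Longrightarrow> G f = G g \<Longrightarrow> f = g"
  by (metis FG)

text \<open>The whole ball lies within 1 of 0, so every value of \<open>F\<close> lies within 1 of
  \<open>F 0\<close>. By surjectivity these values include the constants 1 and -1, and only 0 is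
  that close to both.\<close>

lemma F_zero: "F (\<lambda>_. 0) = (\<lambda>_. 0)"
proof
  fix t
  have ball: "(\<lambda>_. c) \<in> unit_ball" if "\<bar>c\<bar> \<le> 1" for c :: real
    using that by (simp add: unit_ball_def)
  have "\<bar>c - F (\<lambda>_. 0) t\<bar> \<le> 1" if "\<bar>c\<bar> \<le> 1" for c :: real
    using nonexpansive[of "G (\<lambda>_. c)" "\<lambda>_. 0" 1 t] ball[OF that] G_ball[OF ball[OF that]] ball[of 0]
    by (simp add: FG unit_ball_def)
  from this[of 1] this[of "-1"] show "F (\<lambda>_. 0) t = 0" by simp
qed

lemma F_bound:
  assumes "f \<in> unit_ball" "\<And>t. \<bar>f t\<bar> \<le> r"
  shows "\<bar>F f t\<bar> \<le> r"
  using nonexpansive[of f "\<lambda>_. 0" r t] assms by (simp add: F_zero unit_ball_def)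

text \<open>A function within 1/2 of both 0 and \<open>G u\<close> is mapped within 1/2 of both 0
  and \<open>u\<close>, hence to \<open>u / 2\<close>. By injectivity there is only one such
  function, which forces \<open>G u\<close> to have modulus 1 everywhere.\<close>

lemma G_sign:
  assumes u: "u \<in> sign_functions"
  shows "G u \<in> sign_functions"
proof -
  let ?x = "G u"
  have x: "?x \<in> unit_ball" by (intro G_ball sign_functions_subset u)
  have cx: "continuous_on UNIV ?x" and bx: "\<bar>?x t\<bar> \<le> 1" for t
    using x by (auto simp: unit_ball_def)
  have half: "F f = (\<lambda>t. u t / 2)"
    if f: "f \<in> unit_ball" "\<And>t. \<bar>f t\<bar> \<le> 1/2" "\<And>t. \<bar>f t - ?x t\<bar> \<le> 1/2" for f
  proof
    fix t
    have "\<bar>F f t\<bar> \<le> 1/2" using F_bound f by blast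
    moreover have "\<bar>F f t - u t\<bar> \<le> 1/2"
      using nonexpansive[of f ?x "1/2" t] f x FG[OF sign_functions_subset[OF u]] by simp
    ultimately show "F f t = u t / 2" using sign_functionsD[OF u, of t] by auto
  qed
  define f where "f t = ?x t / 2" for t
  \<comment> \<open>The added term is the largest upward shift of \<open>f\<close> that respects
    both distance bounds; it vanishes exactly where \<open>G u\<close> has modulus 1.\<close>
  define g where "g t = ?x t / 2 + (1 - \<bar>?x t\<bar>) / 2" for t
  have f1: "\<bar>f t\<bar> \<le> 1/2" and f2: "\<bar>f t - ?x t\<bar> \<le> 1/2" for t
    using bx[of t] by (auto simp: f_def)
  have g1: "\<bar>g t\<bar> \<le> 1/2" and g2: "\<bar>g t - ?x t\<bar> \<le> 1/2" for t
    using bx[of t] by (auto simp: g_def abs_if field_simps split: if_splits)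
  have "continuous_on UNIV f" using cx unfolding f_def[abs_def] by (intro continuous_intros) auto
  then have fb: "f \<in> unit_ball"
  proof (rule unit_ballI)
    show "\<bar>f t\<bar> \<le> 1" for t using f1[of t] by linarith
  qed
  have "continuous_on UNIV g" using cx unfolding g_def[abs_def] by (intro continuous_intros) auto
  then have gb: "g \<in> unit_ball"
  proof (rule unit_ballI)
    show "\<bar>g t\<bar> \<le> 1" for t using g1[of t] by linarith
  qed
  have "f = g" using F_inject[OF fb gb] half[OF fb f1 f2] half[OF gb g1 g2] by simp
  then have "f t = g t" for t by simp
  then have "\<bar>?x t\<bar> = 1" for t by (simp add: f_def g_def)
  then have "?x t = 1 \<or> ?x t = -1" for t by (metis abs_eq_iff abs_1)
  then show ?thesis using cx by (simp add: sign_functions_def)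
qed

text \<open>Inside the ball, the orthant of a sign function is the set of points within distance 1
  of it, and \<open>F\<close> sends the points within 1 of \<open>G u\<close> to points within 1 of
  \<open>u\<close>.\<close>

lemma sign_cone:
  assumes u: "u \<in> sign_functions" and f: "f \<in> unit_ball" "\<And>t. 0 \<le> G u t * f t"
  shows "0 \<le> u t * F f t"
proof -
  have "\<bar>f t - G u t\<bar> \<le> 1" for t
    using sign_functionsD[OF G_sign[OF u], of t] f(2)[of t] unit_ballD(2)[OF f(1), of t] by auto
  then have "\<bar>F f t - u t\<bar> \<le> 1"
    using nonexpansive[of f "G u" 1 t] f(1) u by (simp add: G_ball FG sign_functions_subset)
  then show ?thesis using sign_functionsD[OF u, of t] by auto
qed

text \<open>The average of \<open>G u\<close> and \<open>G (- u)\<close> lies in the orthants of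
  both, so by \<open>sign_cone\<close> its image lies in the opposite orthants of \<open>u\<close>
  and \<open>- u\<close>. The image is therefore 0, and so is the average.\<close>

lemma G_uminus:
  assumes u: "u \<in> sign_functions"
  shows "G (\<lambda>t. - u t) = (\<lambda>t. - G u t)"
proof -
  have u': "(\<lambda>t. - u t) \<in> sign_functions"
    by (rule sign_functions_uminus[OF u])
  let ?x = "G u" and ?y = "G (\<lambda>t. - u t)"
  define f where "f t = (?x t + ?y t) / 2" for t
  have s: "?x t = 1 \<or> ?x t = -1" "?y t = 1 \<or> ?y t = -1" for t
    using sign_functionsD[OF G_sign] u u' by blast+
  have "continuous_on UNIV f" unfolding f_def[abs_def]
    using G_sign[OF u] G_sign[OF u'] by (auto simp: sign_functions_def intro!: continuous_intros)
  moreover have "\<bar>f t\<bar> \<le> 1" "0 \<le> ?x t * f t" "0 \<le> ?y t * f t" for t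
    using s[of t] by (auto simp: f_def)
  ultimately have f: "f \<in> unit_ball" "\<And>t. 0 \<le> ?x t * f t" "\<And>t. 0 \<le> ?y t * f t"
    by (auto simp: unit_ball_def)
  have "F f t = 0" for t
    using sign_cone[OF u f(1,2), of t] sign_cone[OF u' f(1,3), of t] sign_functionsD[OF u, of t] by auto
  then have "F f = F (\<lambda>_. 0)" by (auto simp: F_zero)
  then have "f = (\<lambda>_. 0)" by (rule F_inject[OF f(1) unit_ball_const, rotated]) simp
  then have "f t = 0" for t by simp
  then have "?y t = - ?x t" for t by (simp add: f_def add_eq_0_iff)
  then show ?thesis by (rule ext)
qed

text \<open>Both segments are mapped to paths from 0 inside one half-line, that of functions
  supported at \<open>d\<close> with sign \<open>c\<close>. By the intermediate value theorem the
  paths share a nonzero value, and injectivity of \<open>F\<close> identifies the preimages.\<close>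

lemma rays_overlap:
  assumes f: "f \<in> unit_ball" "f \<noteq> (\<lambda>_. 0)" and g: "g \<in> unit_ball" "g \<noteq> (\<lambda>_. 0)"
    and c: "c = 1 \<or> c = (-1::real)"
    and Ff: "\<And>a t. 0 \<le> a \<Longrightarrow> a \<le> 1 \<Longrightarrow> t \<noteq> d \<Longrightarrow> F (\<lambda>s. a * f s) t = 0"
      "\<And>a. 0 \<le> a \<Longrightarrow> a \<le> 1 \<Longrightarrow> 0 \<le> c * F (\<lambda>s. a * f s) d"
    and Fg: "\<And>a t. 0 \<le> a \<Longrightarrow> a \<le> 1 \<Longrightarrow> t \<noteq> d \<Longrightarrow> F (\<lambda>s. a * g s) t = 0"
      "\<And>a. 0 \<le> a \<Longrightarrow> a \<le> 1 \<Longrightarrow> 0 \<le> c * F (\<lambda>s. a * g s) d"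
  obtains a b where "0 < a" "0 < b" "\<And>s. a * f s = b * g s"
proof -
  have ball: "(\<lambda>s. a * h s) \<in> unit_ball" if "h \<in> unit_ball" "0 \<le> a" "a \<le> 1" for h :: "'a \<Rightarrow> real" and a
    using that by (intro unit_ball_mult unit_ball_const) auto
  have ivt: "\<exists>a. 0 < a \<and> a \<le> 1 \<and> c * F (\<lambda>s. a * h s) d = y"
    if h: "h \<in> unit_ball" and y: "0 < y" "y \<le> c * F h d" for h y
  proof -
    have "continuous_on {0..1} (\<lambda>a. c * F (\<lambda>s. a * h s) d)"
    proof (rule lipschitz_on_continuous_on[of 1], rule lipschitz_onI)
      fix a b :: real assume ab: "a \<in> {0..1}" "b \<in> {0..1}"
      have "\<bar>a * h s - b * h s\<bar> \<le> \<bar>a - b\<bar>" for s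
        using h by (simp add: left_diff_distrib[symmetric] abs_mult unit_ball_def mult_left_le)
      then have "\<bar>F (\<lambda>s. a * h s) d - F (\<lambda>s. b * h s) d\<bar> \<le> \<bar>a - b\<bar>"
        using ab by (intro nonexpansive ball h) auto
      then show "dist (c * F (\<lambda>s. a * h s) d) (c * F (\<lambda>s. b * h s) d) \<le> 1 * dist a b"
        using c by (auto simp: dist_real_def abs_minus_commute)
    qed simp
    moreover have "c * F (\<lambda>s. 0 * h s) d \<le> y" "y \<le> c * F (\<lambda>s. 1 * h s) d"
      using y by (simp_all add: F_zero)
    ultimately obtain a where a: "0 \<le> a" "a \<le> 1" "c * F (\<lambda>s. a * h s) d = y"
      using IVT'[of "\<lambda>a. c * F (\<lambda>s. a * h s) d" 0 y 1] by auto
    have "a \<noteq> 0"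
    proof
      assume "a = 0"
      then show False using a(3) y(1) by (simp add: F_zero)
    qed
    then show ?thesis using a by (intro exI[of _ a]) simp
  qed
  have pos: "0 < c * F h d"
    if h: "h \<in> unit_ball" "h \<noteq> (\<lambda>_. 0)"
      and Fh: "\<And>a t. 0 \<le> a \<Longrightarrow> a \<le> 1 \<Longrightarrow> t \<noteq> d \<Longrightarrow> F (\<lambda>s. a * h s) t = 0"
      "\<And>a. 0 \<le> a \<Longrightarrow> a \<le> 1 \<Longrightarrow> 0 \<le> c * F (\<lambda>s. a * h s) d" for h
  proof -
    have "F h \<noteq> F (\<lambda>_. 0)" using F_inject[OF h(1)] h(2) by (auto simp: unit_ball_def)
    then obtain t where "F h t \<noteq> 0" by (auto simp: F_zero)
    then have "F h d \<noteq> 0" using Fh(1)[of 1 t] by (cases "t = d") auto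
    then show ?thesis using Fh(2)[of 1] c by auto
  qed
  define y where "y = min (c * F f d) (c * F g d)"
  have y: "0 < y" "y \<le> c * F f d" "y \<le> c * F g d"
    unfolding y_def using pos[OF f Ff] pos[OF g Fg] by auto
  obtain a where a: "0 < a" "a \<le> 1" "c * F (\<lambda>s. a * f s) d = y" using ivt[OF f(1) y(1,2)] by auto
  obtain b where b: "0 < b" "b \<le> 1" "c * F (\<lambda>s. b * g s) d = y" using ivt[OF g(1) y(1,3)] by auto
  have "F (\<lambda>s. a * f s) t = F (\<lambda>s. b * g s) t" for t
    using Ff(1)[of a t] Fg(1)[of b t] a b c by (cases "t = d") auto
  then have "F (\<lambda>s. a * f s) = F (\<lambda>s. b * g s)" by (rule ext)
  then have "(\<lambda>s. a * f s) = (\<lambda>s. b * g s)"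
    by (rule F_inject[rotated 2]) (use a b f g ball in auto)
  then have "a * f s = b * g s" for s by (rule fun_cong)
  then show thesis by (rule that[OF a(1) b(1)])
qed

section \<open>Flipping one sign at an isolated point\<close>

lemma flip_sign:
  assumes "u \<in> sign_functions" "d \<in> D"
  shows "u(d := - u d) \<in> sign_functions"
  using assms continuous_on_fun_upd_isolated[of d u "- u d"]
  unfolding sign_functions_def by (simp del: fun_upd_apply) auto

text \<open>With \<open>v\<close> the flipped function, \<open>f\<close> lives where
  \<open>G u\<close> and \<open>G v\<close> disagree, so it lies in the orthants of
  \<open>G u\<close> and of \<open>- G v = G (- v)\<close>. Hence \<open>F f\<close> lies in the
  orthants of \<open>u\<close> and \<open>- v\<close>, which are opposite at every point other than
  \<open>d\<close>.\<close>

lemma flip_cone: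
  assumes u: "u \<in> sign_functions" and d: "d \<in> D" and f: "f \<in> unit_ball"
    and x: "\<And>t. 0 \<le> G u t * f t" and y: "\<And>t. G u t = G (u(d := - u d)) t \<Longrightarrow> f t = 0"
  shows "t \<noteq> d \<Longrightarrow> F f t = 0" and "0 \<le> u d * F f d"
proof -
  let ?v = "u(d := - u d)"
  have v: "?v \<in> sign_functions" by (rule flip_sign[OF u d])
  then have v': "(\<lambda>t. - ?v t) \<in> sign_functions"
    by (rule sign_functions_uminus)
  have "0 \<le> G (\<lambda>t. - ?v t) t * f t" for t
    unfolding G_uminus[OF v]
    using x[of t] y[of t] sign_functionsD[OF G_sign[OF u], of t] sign_functionsD[OF G_sign[OF v], of t]
    by auto
  then have "0 \<le> - ?v t * F f t" for t using sign_cone[OF v' f] by blast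
  moreover have "0 \<le> u t * F f t" for t using sign_cone[OF u f x] by blast
  ultimately show "t \<noteq> d \<Longrightarrow> F f t = 0" and "0 \<le> u d * F f d"
  proof -
    assume neg: "\<And>t. 0 \<le> - ?v t * F f t" and pos: "\<And>t. 0 \<le> u t * F f t"
    show "0 \<le> u d * F f d" by (rule pos)
    show "F f t = 0" if "t \<noteq> d"
      using neg[of t] pos[of t] that sign_functionsD[OF u, of t] by auto
  qed
qed

text \<open>The set \<open>Z\<close> where the two images disagree is clopen, and nonempty by
  injectivity. If it had two points, a clopen set would split it, and \<open>G u\<close> cut off to
  each piece would give disjointly supported rays whose images share a half-line at
  \<open>d\<close>, against \<open>rays_overlap\<close>.\<close>

lemma G_flip:
  assumes u: "u \<in> sign_functions" and d: "d \<in> D"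
  obtains p where "p \<in> D" "G (u(d := - u d)) = (G u)(p := - G u p)"
proof -
  let ?v = "u(d := - u d)" and ?x = "G u"
  let ?y = "G ?v"
  have v: "?v \<in> sign_functions" by (rule flip_sign[OF u d])
  have sx: "?x t = 1 \<or> ?x t = -1" and sy: "?y t = 1 \<or> ?y t = -1" for t
    using sign_functionsD[OF G_sign] u v by blast+
  have cx: "continuous_on UNIV ?x" and cy: "continuous_on UNIV ?y"
    using G_sign u v by (auto simp: sign_functions_def)
  define Z where "Z = {t. ?x t \<noteq> ?y t}"
  have Zo: "open Z" unfolding Z_def by (intro open_Collect_neq cx cy)
  have "Z = {t. ?x t = - ?y t}" 
  proof -
    have "?x t \<noteq> ?y t \<longleftrightarrow> ?x t = - ?y t" for t using sx[of t] sy[of t] by auto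
    then show ?thesis by (simp add: Z_def)
  qed
  then have Zc: "closed Z" by (simp add: closed_Collect_eq cx cy continuous_on_minus)
  have "?v \<noteq> u" using sign_functionsD[OF u, of d] by (auto simp: fun_eq_iff)
  then have "?x \<noteq> ?y" using G_inject u v sign_functions_subset by metis
  then obtain p where p: "p \<in> Z" by (auto simp: Z_def)
  have "q = p" if q: "q \<in> Z" for q
  proof (rule ccontr)
    assume "q \<noteq> p"
    then obtain V where V: "open V" "closed V" "p \<in> V" "V \<subseteq> Z - {q}"
      using clopen_basis[of "Z - {q}" p] p Zo by auto
    define f where "f = (\<lambda>W t. if t \<in> W then ?x t else 0)"
    have f: "f W \<in> unit_ball" if "open W" "closed W" for W
    proof (rule unit_ballI)
      show "continuous_on UNIV (f W)"
        unfolding f_def by (intro continuous_on_if_clopen that cx continuous_on_const)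
      show "\<bar>f W t\<bar> \<le> 1" for t using sx[of t] by (auto simp: f_def)
    qed
    have fa: "(\<lambda>s. a * f W s) \<in> unit_ball" if "open W" "closed W" "0 \<le> a" "a \<le> 1" for W a
      using that by (intro unit_ball_mult unit_ball_const f) auto
    have pos: "0 \<le> ?x t * (a * f W t)" if "0 \<le> a" for W a t
      using that sx[of t] by (auto simp: f_def)
    have van: "a * f W t = 0" if "W \<subseteq> Z" "?x t = ?y t" for W a t
      using that by (auto simp: f_def Z_def)
    have W: "open (Z - V)" "closed (Z - V)" "Z - V \<subseteq> Z" "V \<subseteq> Z"
      using V Zo Zc by auto
    have nz: "f W \<noteq> (\<lambda>_. 0)" if "r \<in> W" for W r
      using that sx[of r] by (auto simp: f_def fun_eq_iff intro!: exI[of _ r])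
    obtain a b where ab: "0 < a" "0 < (b::real)" "\<And>s. a * f V s = b * f (Z - V) s"
    proof (rule rays_overlap[where d = d and c = "u d" and f = "f V" and g = "f (Z - V)"])
      show "f V \<in> unit_ball" "f (Z - V) \<in> unit_ball" using f V W by auto
      show "f V \<noteq> (\<lambda>_. 0)" using nz[of p] V by simp
      show "f (Z - V) \<noteq> (\<lambda>_. 0)" using nz[of q "Z - V"] V q by auto
      show "u d = 1 \<or> u d = -1" by (rule sign_functionsD[OF u])
      fix a :: real assume a: "0 \<le> a" "a \<le> 1"
      show "F (\<lambda>s. a * f V s) t = 0" if "t \<noteq> d" for t
        using flip_cone(1)[OF u d fa[OF V(1,2) a] pos[OF a(1)] van[OF W(4)] that] .
      show "0 \<le> u d * F (\<lambda>s. a * f V s) d"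
        using flip_cone(2)[OF u d fa[OF V(1,2) a] pos[OF a(1)] van[OF W(4)]] .
      show "F (\<lambda>s. a * f (Z - V) s) t = 0" if "t \<noteq> d" for t
        using flip_cone(1)[OF u d fa[OF W(1,2) a] pos[OF a(1)] van[OF W(3)] that] .
      show "0 \<le> u d * F (\<lambda>s. a * f (Z - V) s) d"
        using flip_cone(2)[OF u d fa[OF W(1,2) a] pos[OF a(1)] van[OF W(3)]] .
    qed (rule that)
    show False using ab(3)[of p] ab(1) V(3) sx[of p] by (auto simp: f_def)
  qed
  then have Z: "Z = {p}" using p by blast
  show thesis
  proof (rule that)
    show "p \<in> D" using Z Zo by simp
    show "?y = ?x(p := - ?x p)"
    proof
      fix t show "?y t = (?x(p := - ?x p)) t"
      proof (cases "t = p")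
        case True
        then have "?x t \<noteq> ?y t" using p by (simp add: Z_def)
        then show ?thesis using True sx[of t] sy[of t] by auto
      next
        case False
        then have "t \<notin> Z" by (simp add: Z)
        then show ?thesis using False by (simp add: Z_def)
      qed
    qed
  qed
qed

text \<open>Consider the spikes of \<open>G u\<close> at \<open>p\<close> and of \<open>G v\<close>
  at \<open>q\<close>. Since \<open>u d = v d\<close>, their rays are mapped into the same half-line
  at \<open>d\<close>, so \<open>rays_overlap\<close> makes the spikes positive multiples of each
  other.\<close>

lemma flip_point_unique:
  assumes d: "d \<in> D" and u: "u \<in> sign_functions" and v: "v \<in> sign_functions" and eq: "u d = v d"
    and p: "p \<in> D" "G (u(d := - u d)) = (G u)(p := - G u p)"
    and q: "q \<in> D" "G (v(d := - v d)) = (G v)(q := - G v q)"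
  shows "p = q" "G u p = G v q"
proof -
  define f where "f w r = (\<lambda>t. if t \<in> {r} then G w r else 0)" for w and r :: 'a
  have ray: "(\<lambda>s. a * f w r s) \<in> unit_ball" "0 \<le> G w t * (a * f w r t)"
    "G w t = G (w(d := - w d)) t \<Longrightarrow> a * f w r t = 0" "f w r \<noteq> (\<lambda>_. 0)"
    if w: "w \<in> sign_functions" and r: "r \<in> D" "G (w(d := - w d)) = (G w)(r := - G w r)"
      and a: "0 \<le> a" "a \<le> 1" for w r a t
  proof -
    have s: "G w r = 1 \<or> G w r = -1" by (rule sign_functionsD[OF G_sign[OF w]])
    have "continuous_on UNIV (f w r)" unfolding f_def
      by (rule continuous_on_if_clopen) (use r in auto)
    moreover have "\<bar>f w r t\<bar> \<le> 1" for t using s by (auto simp: f_def)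
    ultimately show "(\<lambda>s. a * f w r s) \<in> unit_ball"
      using a by (intro unit_ball_mult unit_ball_const unit_ballI) auto
    show "0 \<le> G w t * (a * f w r t)" using s a by (auto simp: f_def)
    show "a * f w r t = 0" if "G w t = G (w(d := - w d)) t" using that s r(2) by (auto simp: f_def)
    show "f w r \<noteq> (\<lambda>_. 0)" using s by (auto simp: f_def fun_eq_iff)
  qed
  obtain a b where ab: "0 < a" "0 < (b::real)" "\<And>s. a * f u p s = b * f v q s"
  proof (rule rays_overlap[where d = d and c = "u d" and f = "f u p" and g = "f v q"])
    show "f u p \<in> unit_ball" using ray(1)[OF u p, of 1] by simp
    show "f v q \<in> unit_ball" using ray(1)[OF v q, of 1] by simp
    show "f u p \<noteq> (\<lambda>_. 0)" using ray(4)[OF u p, of 1] by simp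
    show "f v q \<noteq> (\<lambda>_. 0)" using ray(4)[OF v q, of 1] by simp
    show "u d = 1 \<or> u d = -1" by (rule sign_functionsD[OF u])
    fix a :: real assume a: "0 \<le> a" "a \<le> 1"
    show "F (\<lambda>s. a * f u p s) t = 0" if "t \<noteq> d" for t
      using flip_cone(1)[OF u d ray(1)[OF u p a] ray(2)[OF u p a] ray(3)[OF u p a] that] .
    show "0 \<le> u d * F (\<lambda>s. a * f u p s) d"
      using flip_cone(2)[OF u d ray(1)[OF u p a] ray(2)[OF u p a] ray(3)[OF u p a]] .
    show "F (\<lambda>s. a * f v q s) t = 0" if "t \<noteq> d" for t
      using flip_cone(1)[OF v d ray(1)[OF v q a] ray(2)[OF v q a] ray(3)[OF v q a] that] .
    show "0 \<le> u d * F (\<lambda>s. a * f v q s) d"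
      using flip_cone(2)[OF v d ray(1)[OF v q a] ray(2)[OF v q a] ray(3)[OF v q a]] eq by simp
  qed (rule that)
  have s: "G u p = 1 \<or> G u p = -1" "G v q = 1 \<or> G v q = -1"
    using sign_functionsD[OF G_sign] u v by blast+
  show pq: "p = q" using ab(3)[of p] ab(1) s by (auto simp: f_def split: if_splits)
  show "G u p = G v q" using ab(3)[of p] ab(1,2) s pq by (auto simp: f_def)
qed

text \<open>Both \<open>p\<close> and \<open>\<eta>\<close> are read off from the constant 1, with
  \<open>\<eta> d\<close> the value of \<open>G 1\<close> at \<open>p d\<close>;
  \<open>flip_point_unique\<close> carries them over to every sign function.\<close>

lemma G_on_signs:
  obtains p \<eta> where "\<And>d. d \<in> D \<Longrightarrow> p d \<in> D" "\<And>d. d \<in> D \<Longrightarrow> \<eta> d = 1 \<or> \<eta> d = (-1::real)"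
    "\<And>d u. d \<in> D \<Longrightarrow> u \<in> sign_functions \<Longrightarrow> G u (p d) = \<eta> d * u d"
    "\<And>d u. d \<in> D \<Longrightarrow> u \<in> sign_functions \<Longrightarrow> G (u(d := - u d)) = (G u)(p d := - G u (p d))"
proof -
  let ?o = "\<lambda>_::'a. 1::real"
  have o: "?o \<in> sign_functions" by (simp add: sign_functions_def)
  have "\<forall>d\<in>D. \<exists>p. p \<in> D \<and> G (?o(d := - ?o d)) = (G ?o)(p := - G ?o p)"
    using G_flip[OF o] by metis
  then obtain p where p: "\<And>d. d \<in> D \<Longrightarrow> p d \<in> D"
      "\<And>d. d \<in> D \<Longrightarrow> G (?o(d := - ?o d)) = (G ?o)(p d := - G ?o (p d))"
    by metis
  have key: "G u (p d) = G ?o (p d) * u d \<and> G (u(d := - u d)) = (G u)(p d := - G u (p d))"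
    if d: "d \<in> D" and u: "u \<in> sign_functions" for d u
  proof -
    obtain q where q: "q \<in> D" "G (u(d := - u d)) = (G u)(q := - G u q)" using G_flip[OF u d] .
    show ?thesis
    proof (cases "u d = 1")
      case True
      then show ?thesis
        using flip_point_unique[OF d o u _ p(1)[OF d] p(2)[OF d] q] q(2) by simp
    next
      case False
      then have ud: "u d = -1" using sign_functionsD[OF u] by blast
      \<comment> \<open>The flipped function has value 1 at \<open>d\<close>, and flipping it back
        flips its image at the same \<open>q\<close>, so it can be compared with the constant
        1.\<close>
      let ?v = "u(d := - u d)"
      have v: "?v \<in> sign_functions" by (rule flip_sign[OF u d])
      have "?v(d := - ?v d) = u" by auto
      moreover have "(G ?v)(q := - G ?v q) = G u" using q(2) by auto
      ultimately have q': "G (?v(d := - ?v d)) = (G ?v)(q := - G ?v q)" by simp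
      have "p d = q" "G ?o (p d) = G ?v q"
        using flip_point_unique[OF d o v _ p(1)[OF d] p(2)[OF d] q(1) q'] ud by auto
      then show ?thesis using q(2) ud by simp
    qed
  qed
  show thesis
    by (rule that[of p "\<lambda>d. G ?o (p d)"]) (use p key sign_functionsD[OF G_sign[OF o]] in blast)+
qed

text \<open>A spike at a missed point \<open>q\<close>, with the sign of \<open>G 1\<close>, lies in
  the orthant of \<open>G 1\<close> and, for each isolated \<open>d\<close>, in that of the image of
  1 flipped at \<open>d\<close>. Its image under \<open>F\<close> then has both signs at
  \<open>d\<close>, so it vanishes on a dense set, which contradicts injectivity.\<close>

lemma flip_point_surj:
  assumes p: "\<And>d. d \<in> D \<Longrightarrow> G ((\<lambda>_. 1)(d := -1)) = (G (\<lambda>_. 1))(p d := - G (\<lambda>_. 1) (p d))"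
  shows "D \<subseteq> p ` D"
proof (rule ccontr)
  assume "\<not> D \<subseteq> p ` D"
  then obtain q where q: "q \<in> D" "q \<notin> p ` D" by blast
  let ?o = "\<lambda>_::'a. 1::real"
  have o: "?o \<in> sign_functions" by (simp add: sign_functions_def)
  let ?x = "G ?o"
  have sx: "?x t = 1 \<or> ?x t = -1" for t using sign_functionsD[OF G_sign[OF o]] .
  define f where "f = (\<lambda>_::'a. 0::real)(q := ?x q)"
  have f: "f \<in> unit_ball"
  proof (rule unit_ballI)
    show "continuous_on UNIV f"
      unfolding f_def using q(1) by (intro continuous_on_fun_upd_isolated) auto
    show "\<bar>f t\<bar> \<le> 1" for t using sx[of q] by (auto simp: f_def)
  qed
  have fx: "0 \<le> ?x t * f t" for t using sx[of q] by (auto simp: f_def)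
  have "F f d = 0" if d: "d \<in> D" for d
  proof -
    let ?v = "?o(d := -1)"
    have v: "?v \<in> sign_functions" using flip_sign[OF o d] by simp
    have "0 \<le> G ?v t * f t" for t
      unfolding p[OF d] using q(2) d fx[of t] by (auto simp: f_def)
    then have "0 \<le> ?v d * F f d" using sign_cone[OF v f] by blast
    moreover have "0 \<le> ?o d * F f d" using sign_cone[OF o f fx] by blast
    ultimately show ?thesis by simp
  qed
  moreover have "continuous_on UNIV (\<lambda>t. \<bar>F f t\<bar>)"
    by (intro continuous_on_rabs unit_ballD(1) F_ball f)
  ultimately have "\<bar>F f t\<bar> \<le> 0" for t
    using dense_imp_le[OF dense_isolated, of "\<lambda>t. \<bar>F f t\<bar>" 0 t] by simp
  then have "F f = F (\<lambda>_. 0)" by (auto simp: F_zero)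
  then have "f = (\<lambda>_. 0)" by (rule F_inject[OF f unit_ball_const, rotated]) simp
  then have "f q = 0" by simp
  then show False using sx[of q] by (auto simp: f_def)
qed

text \<open>Compactness gives a finite clopen cover on whose members \<open>w\<close> stays close to
  its value at a chosen point; the induction overwrites one member at a time. Taking all values from
  \<open>range w\<close> preserves the bounds of \<open>w\<close>.\<close>

lemma finite_range_approx:
  fixes w :: "'a \<Rightarrow> real"
  assumes w: "continuous_on UNIV w" and e: "0 < e"
  obtains g where "continuous_on UNIV g" "finite (range g)" "range g \<subseteq> range w"
    "\<And>t. \<bar>g t - w t\<bar> \<le> e"
proof -
  have "\<exists>V. open V \<and> closed V \<and> t \<in> V \<and> V \<subseteq> {s. \<bar>w s - w t\<bar> < e}" for t
    using e by (intro clopen_basis open_Collect_less continuous_intros w) auto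
  then obtain V where "\<And>t. open (V t) \<and> closed (V t) \<and> t \<in> V t \<and> V t \<subseteq> {s. \<bar>w s - w t\<bar> < e}"
    by metis
  then have V: "\<And>t. open (V t)" "\<And>t. closed (V t)" "\<And>t. t \<in> V t"
      "\<And>t s. s \<in> V t \<Longrightarrow> \<bar>w s - w t\<bar> < e"
    by blast+
  obtain T where T: "finite T" "UNIV \<subseteq> (\<Union>t\<in>T. V t)"
  proof (rule compactE_image[OF compact_space, of UNIV V])
    show "UNIV \<subseteq> (\<Union>t. V t)" using V(3) by blast
  qed (use V(1) that in auto)
  have "\<exists>g. continuous_on UNIV g \<and> finite (range g) \<and> range g \<subseteq> range w \<and>
      (\<forall>s \<in> (\<Union>t\<in>T. V t). \<bar>g s - w s\<bar> \<le> e)"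
    using T(1)
  proof induction
    case empty
    \<comment> \<open>Over no pieces the estimate is vacuous; the constant only has to be some value
      of \<open>w\<close>.\<close>
    show ?case by (rule exI[of _ "\<lambda>_. w undefined"]) auto
  next
    case (insert t T)
    then obtain g where g: "continuous_on UNIV g" "finite (range g)" "range g \<subseteq> range w"
        "\<And>s. s \<in> (\<Union>t\<in>T. V t) \<Longrightarrow> \<bar>g s - w s\<bar> \<le> e" by blast
    define h where "h = (\<lambda>s. if s \<in> V t then w t else g s)"
    have "continuous_on UNIV h"
      unfolding h_def by (intro continuous_on_if_clopen V g continuous_on_const)
    moreover have "range h \<subseteq> insert (w t) (range g)" by (auto simp: h_def)
    then have "finite (range h)" "range h \<subseteq> range w"
      using g(2,3) by (auto intro: finite_subset)
    moreover have "\<bar>h s - w s\<bar> \<le> e" if "s \<in> (\<Union>t\<in>insert t T. V t)" for s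
    proof (cases "s \<in> V t")
      case True
      then show ?thesis using V(4)[OF True] by (simp add: h_def)
    next
      case False
      then show ?thesis using that g(4)[of s] by (auto simp: h_def)
    qed
    ultimately show ?case by blast
  qed
  then show thesis using that T(2) by (metis UNIV_I subsetD)
qed

end

section \<open>Maps fixing the constant 1, on positive functions\<close>

locale normalized_nonexpansive_homeo = nonexpansive_homeo F G
  for F G :: "('a::t2_space \<Rightarrow> real) \<Rightarrow> 'a \<Rightarrow> real" +
  fixes p :: "'a \<Rightarrow> 'a"
  assumes G_one: "G (\<lambda>_. 1) = (\<lambda>_. 1)"
    and G_one_flip: "d \<in> D \<Longrightarrow> G ((\<lambda>_. 1)(d := -1)) = (\<lambda>_. 1)(p d := -1)"
    and surj: "D \<subseteq> p ` D"
begin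

text \<open>The constant 1 flipped at \<open>p d\<close> lies within \<open>1 + f (p d)\<close> of
  \<open>f\<close>, and its image under \<open>F\<close> has value -1 at \<open>d\<close>.\<close>

lemma F_le:
  assumes f: "f \<in> unit_ball" "\<And>t. 0 \<le> f t" and d: "d \<in> D"
  shows "F f d \<le> f (p d)"
proof -
  let ?v = "(\<lambda>_::'a. 1::real)(d := -1)"
  have "(\<lambda>_. 1) \<in> sign_functions" by (simp add: sign_functions_def)
  from flip_sign[OF this d] have v: "?v \<in> unit_ball" by (simp add: sign_functions_subset)
  have "\<bar>f t - G ?v t\<bar> \<le> 1 + f (p d)" for t
    using f(2)[of t] f(2)[of "p d"] unit_ballD(2)[OF f(1), of t] by (auto simp: G_one_flip[OF d])
  then have "\<bar>F f d - F (G ?v) d\<bar> \<le> 1 + f (p d)"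
    by (intro nonexpansive f G_ball v)
  then show ?thesis by (simp add: FG[OF v])
qed

lemma G_ge_of_nonneg:
  assumes w: "w \<in> unit_ball" and G: "\<And>t. 0 \<le> G w t" and d: "d \<in> D"
  shows "w d \<le> G w (p d)"
  using F_le[OF G_ball[OF w] G d] by (simp add: FG[OF w])

text \<open>Let \<open>m\<close> be the infimum of \<open>G\<close> along the segment from 1 to
  \<open>w\<close>. It is continuous, starts at 1, and cannot equal \<open>c / 2\<close>: there the
  image would be nonnegative, so \<open>G_ge_of_nonneg\<close>, surjectivity of \<open>p\<close> and
  density would raise the infimum to at least \<open>c\<close>. Hence it never becomes
  negative.\<close>

lemma G_nonneg:
  assumes w: "w \<in> unit_ball" "\<And>t. c \<le> w t" and c: "0 < c"
  shows "0 \<le> G w t"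
proof (rule ccontr)
  assume neg: "\<not> 0 \<le> G w t"
  have w1: "w t \<le> 1" for t using unit_ballD(2)[OF w(1), of t] by simp
  have c1: "c \<le> 1" using w(2)[of t] w1[of t] by simp
  define W where "W \<theta> = (\<lambda>t. (1 - \<theta>) + \<theta> * w t)" for \<theta>
  have Wc: "c \<le> W \<theta> t" and W1: "W \<theta> t \<le> 1" if "\<theta> \<in> {0..1}" for \<theta> t
  proof -
    have "\<theta> * c \<le> \<theta> * w t" "\<theta> * w t \<le> \<theta> * 1" using that w(2)[of t] w1[of t]
      by (intro mult_left_mono; simp)+
    moreover have "0 \<le> (1 - \<theta>) * (1 - c)" using that c1 by simp
    ultimately show "c \<le> W \<theta> t" "W \<theta> t \<le> 1" by (auto simp: W_def algebra_simps)
  qed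
  have Wb: "W \<theta> \<in> unit_ball" if "\<theta> \<in> {0..1}" for \<theta>
  proof (rule unit_ballI)
    show "continuous_on UNIV (W \<theta>)" unfolding W_def
      by (intro continuous_intros unit_ballD(1) w)
    show "\<bar>W \<theta> t\<bar> \<le> 1" for t using Wc[OF that, of t] W1[OF that, of t] c by simp
  qed
  define m where "m \<theta> = (INF t. G (W \<theta>) t)" for \<theta>
  have m_le: "m \<theta> \<le> G (W \<theta>) t" if "\<theta> \<in> {0..1}" for \<theta> t
  proof -
    have "-1 \<le> G (W \<theta>) t" for t using unit_ballD(2)[OF G_ball[OF Wb[OF that]], of t] by simp
    then have "bdd_below (range (G (W \<theta>)))" by (intro bdd_belowI2[of _ "-1"])
    then show ?thesis unfolding m_def by (intro cINF_lower) auto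
  qed
  have m_ge: "b \<le> m \<theta>" if "\<And>t. b \<le> G (W \<theta>) t" for b \<theta>
    unfolding m_def using that by (intro cINF_greatest) auto
  have "continuous_on {0..1} m"
    unfolding continuous_on_iff
  proof (intro ballI allI impI)
    fix a e :: real assume a: "a \<in> {0..1}" and e: "0 < e"
    obtain \<delta> where \<delta>: "0 < \<delta>" "\<And>g t. g \<in> unit_ball \<Longrightarrow> (\<And>t. \<bar>W a t - g t\<bar> \<le> \<delta>) \<Longrightarrow> \<bar>G (W a) t - G g t\<bar> \<le> e / 2"
      using G_continuous[OF Wb[OF a], of "e / 2"] e by auto
    have "dist (m b) (m a) < e" if b: "b \<in> {0..1}" "dist b a < \<delta>" for b
    proof -
      have "\<bar>W a t - W b t\<bar> \<le> \<delta>" for t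
      proof -
        have "W a t - W b t = (b - a) * (1 - w t)" by (simp add: W_def algebra_simps)
        moreover have "\<bar>b - a\<bar> * \<bar>1 - w t\<bar> \<le> \<bar>b - a\<bar>"
          using w(2)[of t] w1[of t] c by (intro mult_left_le) auto
        ultimately show ?thesis using b(2) by (simp add: abs_mult dist_real_def)
      qed
      then have G: "\<bar>G (W a) t - G (W b) t\<bar> \<le> e / 2" for t using \<delta>(2)[OF Wb[OF b(1)]] by blast
      have "m a - e / 2 \<le> m b" by (rule m_ge) (smt (verit) G m_le[OF a])
      moreover have "m b - e / 2 \<le> m a" by (rule m_ge) (smt (verit) G m_le[OF b(1)])
      ultimately show ?thesis using e by (simp add: dist_real_def)
    qed
    then show "\<exists>\<delta>>0. \<forall>b\<in>{0..1}. dist b a < \<delta> \<longrightarrow> dist (m b) (m a) < e" using \<delta>(1) by blast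
  qed
  moreover have "m 1 \<le> c / 2"
    using m_le[of 1 t] neg c by (simp add: W_def)
  moreover have "c / 2 \<le> m 0" by (rule m_ge) (use c1 c in \<open>simp add: W_def G_one\<close>)
  ultimately obtain \<theta> where \<theta>: "\<theta> \<in> {0..1}" "m \<theta> = c / 2"
    using IVT2'[of m 1 "c / 2" 0] by auto
  have pos: "0 \<le> G (W \<theta>) t" for t using m_le[OF \<theta>(1), of t] \<theta>(2) c by simp
  have "- G (W \<theta>) q \<le> - c" if "q \<in> D" for q
  proof -
    obtain d where "d \<in> D" "q = p d" using \<open>q \<in> D\<close> surj by blast
    then show ?thesis using G_ge_of_nonneg[OF Wb[OF \<theta>(1)] pos, of d] Wc[OF \<theta>(1), of d] by simp
  qed
  moreover have "continuous_on UNIV (\<lambda>t. - G (W \<theta>) t)"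
    by (intro continuous_on_minus unit_ballD(1) G_ball Wb \<theta>)
  ultimately have "- G (W \<theta>) t \<le> - c" for t
    by (rule dense_imp_le[OF dense_isolated, of "\<lambda>t. - G (W \<theta>) t", rotated])
  then have "c \<le> m \<theta>" by (intro m_ge) simp
  then show False using \<theta>(2) c by simp
qed

lemma G_ge:
  assumes "w \<in> unit_ball" "finite (range w)" "\<And>t. 0 < w t" "d \<in> D"
  shows "w d \<le> G w (p d)"
proof (rule G_ge_of_nonneg)
  have "Min (range w) \<in> range w" using assms(2) by (intro Min_in) auto
  then have "0 < Min (range w)" using assms(3) by auto
  then show "0 \<le> G w t" for t using assms by (intro G_nonneg[of w "Min (range w)"]) auto
qed (use assms in auto)

text \<open>Lowering \<open>w\<close> slightly at the isolated point \<open>d\<close> makes \<open>d\<close> the unique point realising the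
  distance from \<open>w\<close> to the function obtained by raising to \<open>1\<close> all values \<open>\<ge> w d\<close>; smaller values are
  already known to be preserved, so expansiveness of \<open>G\<close> bounds \<open>G w (p d)\<close> from above.\<close>

lemma G_finite_range:
  assumes "w \<in> unit_ball" "finite (range w)" "\<And>t. 0 < w t" "d \<in> D"
  shows "G w (p d) = w d"
  using assms
proof (induction "card {v \<in> range w. v < w d}" arbitrary: w d rule: less_induct)
  case less
  note w = less.prems(1) and fin = less.prems(2) and pos = less.prems(3) and d = less.prems(4)
  define L where "L = {v \<in> range w. v < w d}"
  have finL: "finite L" using fin by (auto simp: L_def)
  \<comment> \<open>The next smaller value of \<open>w\<close>, or 0 if there is none: lowering
    \<open>w d\<close> by less than \<open>w d - l\<close> keeps it positive and above every value
    in \<open>L\<close>.\<close>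
  define l where "l = Max (insert 0 L)"
  have l: "0 \<le> l" "\<And>v. v \<in> L \<Longrightarrow> v \<le> l" using finL by (auto simp: l_def)
  have "l \<in> insert 0 L" unfolding l_def using finL by (intro Max_in) auto
  then have lw: "l < w d" using pos[of d] by (auto simp: L_def)
  have wd1: "w d \<le> 1" using unit_ballD(2)[OF w, of d] by simp
  have lowered: "w(d := w d - e) \<in> unit_ball \<and> G (w(d := w d - e)) (p d) = w d - e"
    if e: "0 < e" "e < w d - l" for e
  proof -
    define W where "W = w(d := w d - e)"
    have Wd: "W d = w d - e" and Wt: "\<And>t. t \<noteq> d \<Longrightarrow> W t = w t" by (auto simp: W_def)
    have Wpos: "0 < W t" for t using e l(1) pos[of t] by (cases "t = d") (auto simp: Wd Wt)
    have W1: "W t \<le> 1" for t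
      using e wd1 unit_ballD(2)[OF w, of t] by (cases "t = d") (auto simp: Wd Wt)
    have Wb: "W \<in> unit_ball"
    proof (rule unit_ballI)
      show "continuous_on UNIV W" unfolding W_def
        using d by (intro continuous_on_fun_upd_isolated unit_ballD(1) w) auto
      show "\<bar>W t\<bar> \<le> 1" for t using Wpos[of t] W1[of t] by simp
    qed
    have "range W \<subseteq> insert (w d - e) (range w)" by (auto simp: W_def)
    then have Wfin: "finite (range W)" using fin by (auto intro: finite_subset)
    define h where "h v = (if v < W d then v else 1)" for v
    define W' where "W' = (\<lambda>t. h (W t))"
    have W'pos: "0 < W' t" and W'1: "W' t \<le> 1" for t
      using Wpos[of t] W1[of t] by (auto simp: W'_def h_def)
    have W'b: "W' \<in> unit_ball"
    proof (rule unit_ballI)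
      show "continuous_on UNIV W'" unfolding W'_def
        by (rule continuous_on_comp_finite_range[OF unit_ballD(1)[OF Wb] Wfin])
      show "\<bar>W' t\<bar> \<le> 1" for t using W'pos[of t] W'1[of t] by simp
    qed
    have "range W' = h ` range W" by (auto simp: W'_def)
    then have W'fin: "finite (range W')" using Wfin by simp
    have preserved: "G W (p b) = W b" "G W' (p b) = W b" if b: "b \<in> D" "W b < W d" for b
    proof -
      have W'b_eq: "W' b = W b" using b(2) by (simp add: W'_def h_def)
      have wb: "W b = w b" using b(2) Wt[of b] by (cases "b = d") auto
      \<comment> \<open>The value \<open>W b\<close> belongs to \<open>L\<close> but is not below
        itself, so the count strictly drops and the induction hypothesis applies at
        \<open>b\<close>, to \<open>W\<close> and to \<open>W'\<close> alike.\<close>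
      have sub: "{v \<in> range W. v < W b} \<subseteq> L - {W b}"
      proof
        fix v assume "v \<in> {v \<in> range W. v < W b}"
        then obtain t where t: "v = W t" "W t < W b" by auto
        then have "t \<noteq> d" using b(2) by auto
        then show "v \<in> L - {W b}" using t b(2) e by (auto simp: L_def Wt Wd)
      qed
      have sub': "{v \<in> range W'. v < W' b} \<subseteq> {v \<in> range W. v < W b}"
        using W1[of b] by (auto simp: W'b_eq) (auto simp: W'_def h_def split: if_splits)
      have "W b \<in> L" using wb b(2) e by (auto simp: L_def Wd)
      then have less: "card (L - {W b}) < card L" using finL by (intro psubset_card_mono) auto
      have "card {v \<in> range W. v < W b} \<le> card (L - {W b})" using finL sub by (intro card_mono) auto
      then have "card {v \<in> range W. v < W b} < card {v \<in> range w. v < w d}"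
        using less by (simp add: L_def)
      then show "G W (p b) = W b" using less.hyps Wb Wfin Wpos b(1) by blast
      have "card {v \<in> range W'. v < W' b} \<le> card (L - {W b})"
        using finL sub sub' by (intro card_mono) auto
      then have "card {v \<in> range W'. v < W' b} < card {v \<in> range w. v < w d}"
        using less by (simp add: L_def)
      then have "G W' (p b) = W' b" using less.hyps W'b W'fin W'pos b(1) by blast
      then show "G W' (p b) = W b" using W'b_eq by simp
    qed
    have ge: "W b \<le> G W (p b)" "W' b \<le> G W' (p b)" if "b \<in> D" for b
      by (rule G_ge[OF Wb Wfin Wpos that], rule G_ge[OF W'b W'fin W'pos that])
    have le1: "G W t \<le> 1" "G W' t \<le> 1" for t
      using unit_ballD(2)[OF G_ball[OF Wb], of t] unit_ballD(2)[OF G_ball[OF W'b], of t] by auto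
    have "G W (p d) \<le> W d"
    proof (rule ccontr)
      assume "\<not> G W (p d) \<le> W d"
      then have gt: "W d < G W (p d)" by simp
      \<comment> \<open>Both entries are smaller than \<open>1 - W d\<close>, the distance between
        \<open>W\<close> and \<open>W'\<close> at \<open>d\<close>. A bound \<open>r\<close> on the
        distance of their images thus contradicts expansiveness.\<close>
      define r where "r = max (1 - w d) (1 - G W (p d))"
      have "\<bar>G W q - G W' q\<bar> \<le> r" if q: "q \<in> D" for q
      proof -
        obtain b where b: "b \<in> D" "q = p b" using q surj by blast
        consider "W b < W d" | "b = d" | "b \<noteq> d" "W d \<le> W b" by linarith
        then show ?thesis
        proof cases
          case 1
          then show ?thesis using preserved[OF b(1)] wd1 by (simp add: b r_def)
        next
          case 2
          have "W' d = 1" by (simp add: W'_def h_def)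
          then have "G W' (p d) = 1" using ge(2)[OF d] le1(2)[of "p d"] by simp
          then show ?thesis using 2 le1(1)[of "p d"] by (simp add: b r_def)
        next
          case 3
          have "W' b = 1" using 3 by (simp add: W'_def h_def)
          then have "G W' (p b) = 1" using ge(2)[OF b(1)] le1(2)[of "p b"] by simp
          \<comment> \<open>No value of \<open>w\<close> lies strictly between \<open>l\<close> and
            \<open>w d\<close>, while \<open>W d\<close> exceeds \<open>l\<close>.\<close>
          moreover have "w d \<le> w b"
          proof (rule ccontr)
            assume "\<not> w d \<le> w b"
            then have "w b \<le> l" by (intro l(2)) (auto simp: L_def)
            then show False using 3 e by (simp add: Wd Wt)
          qed
          then have "w d \<le> G W (p b)" using ge(1)[OF b(1)] 3(1) by (simp add: Wt)
          ultimately show ?thesis using le1(1)[of "p b"] by (simp add: b r_def)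
        qed
      qed
      moreover have "continuous_on UNIV (\<lambda>t. \<bar>G W t - G W' t\<bar>)"
        by (intro continuous_intros unit_ballD(1) G_ball Wb W'b)
      ultimately have "\<bar>G W t - G W' t\<bar> \<le> r" for t
        by (rule dense_imp_le[OF dense_isolated, of "\<lambda>t. \<bar>G W t - G W' t\<bar>", rotated])
      then have "\<bar>W d - W' d\<bar> \<le> r" by (rule G_expansive[OF Wb W'b])
      moreover have "W' d = 1" by (simp add: W'_def h_def)
      ultimately show False using gt e W1[of d] by (auto simp: r_def Wd)
    qed
    then have "G W (p d) = w d - e" using ge(1)[OF d] Wd by simp
    then show ?thesis using Wb by (simp add: W_def)
  qed
  show ?case
  proof (rule ccontr)
    assume ne: "G w (p d) \<noteq> w d"
    \<comment> \<open>Continuity of \<open>G\<close> costs one \<open>k\<close> and the lowering by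
      \<open>e\<close> at most another, so thirds leave a contradiction.\<close>
    define k where "k = \<bar>G w (p d) - w d\<bar> / 3"
    have k: "0 < k" using ne by (simp add: k_def)
    obtain \<delta> where \<delta>: "0 < \<delta>" "\<And>g t. g \<in> unit_ball \<Longrightarrow> (\<And>t. \<bar>w t - g t\<bar> \<le> \<delta>) \<Longrightarrow> \<bar>G w t - G g t\<bar> \<le> k"
      using G_continuous[OF w k] by auto
    define e where "e = min (min \<delta> k) ((w d - l) / 2)"
    have e: "0 < e" "e < w d - l" "e \<le> \<delta>" "e \<le> k" using \<delta>(1) k lw by (auto simp: e_def min_def)
    note low = lowered[OF e(1,2)]
    have "\<bar>G w (p d) - G (w(d := w d - e)) (p d)\<bar> \<le> k"
      by (rule \<delta>(2)) (use low e in auto)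
    then have "\<bar>G w (p d) - w d\<bar> \<le> 2 * k" using low e(1,4) by linarith
    then show False using k by (simp add: k_def)
  qed
qed

end

section \<open>Arbitrary signs and the isometry property\<close>

context nonexpansive_homeo
begin

text \<open>Conjugating by multiplication with \<open>u\<close> and \<open>G u\<close> moves the orthant of \<open>u\<close> to the positive one.\<close>

lemma conjugate_normalized:
  assumes u: "u \<in> sign_functions" and surj: "D \<subseteq> p ` D"
    and flip: "\<And>d. d \<in> D \<Longrightarrow> G (u(d := - u d)) = (G u)(p d := - G u (p d))"
  shows "normalized_nonexpansive_homeo (\<lambda>f t. u t * F (\<lambda>s. G u s * f s) t)
    (\<lambda>f t. G u t * G (\<lambda>s. u s * f s) t) p"
proof -
  note ub = sign_functions_subset[OF u] and xb = sign_functions_subset[OF G_sign[OF u]]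
  have uu: "u t * (u t * a) = a" and ua: "\<bar>u t * a - u t * b\<bar> = \<bar>a - b\<bar>" for t a b
    using sign_functionsD[OF u, of t] by auto
  have xx: "G u t * (G u t * a) = a" and xa: "\<bar>G u t * a - G u t * b\<bar> = \<bar>a - b\<bar>" for t a b
    using sign_functionsD[OF G_sign[OF u], of t] by auto
  show ?thesis
  proof (unfold_locales)
    fix f :: "'a \<Rightarrow> real" assume f: "f \<in> unit_ball"
    note uf = unit_ball_mult[OF ub f] and xf = unit_ball_mult[OF xb f]
    show "(\<lambda>t. u t * F (\<lambda>s. G u s * f s) t) \<in> unit_ball"
      by (intro unit_ball_mult ub F_ball xf)
    show "(\<lambda>t. G u t * G (\<lambda>s. u s * f s) t) \<in> unit_ball"
      by (intro unit_ball_mult xb G_ball uf)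
    show "(\<lambda>t. G u t * G (\<lambda>s. u s * (u s * F (\<lambda>s. G u s * f s) s)) t) = f"
      by (simp add: uu GF[OF xf] xx)
    show "(\<lambda>t. u t * F (\<lambda>s. G u s * (G u s * G (\<lambda>s. u s * f s) s)) t) = f"
      by (simp add: xx FG[OF uf] uu)
    show "\<bar>u t * F (\<lambda>s. G u s * f s) t - u t * F (\<lambda>s. G u s * g s) t\<bar> \<le> r"
      if g: "g \<in> unit_ball" and r: "\<And>t. \<bar>f t - g t\<bar> \<le> r" for g r t
      unfolding ua using r by (intro nonexpansive xf unit_ball_mult xb g) (simp add: xa)
    show "\<exists>\<delta>>0. \<forall>g\<in>unit_ball. (\<forall>t. \<bar>f t - g t\<bar> \<le> \<delta>) \<longrightarrow>
        (\<forall>t. \<bar>G u t * G (\<lambda>s. u s * f s) t - G u t * G (\<lambda>s. u s * g s) t\<bar> \<le> e)"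
      if e: "0 < e" for e :: real
    proof -
      obtain \<delta> where \<delta>: "0 < \<delta>" "\<And>g. g \<in> unit_ball \<Longrightarrow> \<forall>t. \<bar>u t * f t - g t\<bar> \<le> \<delta> \<Longrightarrow>
          \<forall>t. \<bar>G (\<lambda>s. u s * f s) t - G g t\<bar> \<le> e"
        using G_continuous[OF uf e] by blast
      have "\<forall>t. \<bar>G u t * G (\<lambda>s. u s * f s) t - G u t * G (\<lambda>s. u s * g s) t\<bar> \<le> e"
        if "g \<in> unit_ball" "\<forall>t. \<bar>f t - g t\<bar> \<le> \<delta>" for g
        using \<delta>(2)[OF unit_ball_mult[OF ub that(1)]] that(2) by (simp add: ua xa)
      then show ?thesis using \<delta>(1) by blast
    qed
  next
    show "(\<lambda>t. G u t * G (\<lambda>s. u s * 1) t) = (\<lambda>_. 1)"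
      using xx[where a = 1] by simp
    fix d :: 'a assume d: "d \<in> D"
    have "(\<lambda>s. u s * ((\<lambda>_. 1)(d := -1)) s) = u(d := - u d)" by auto
    then show "(\<lambda>t. G u t * G (\<lambda>s. u s * ((\<lambda>_. 1)(d := -1)) s) t) = (\<lambda>_. 1)(p d := -1)"
      using xx[where a = 1] by (simp only: flip[OF d]) (auto simp: fun_eq_iff)
  qed (rule compact_space clopen_basis dense_isolated surj; assumption)+
qed

text \<open>Once \<open>formula\<close> holds, the difference of \<open>f\<close> and
  \<open>g\<close> at \<open>p d\<close> has the same modulus as that of \<open>F f\<close> and
  \<open>F g\<close> at \<open>d\<close>. The points \<open>p d\<close> cover the isolated points,
  and density does the rest.\<close>

theorem F_isometry:
  assumes f: "f \<in> unit_ball" and g: "g \<in> unit_ball" and r: "\<And>t. \<bar>F f t - F g t\<bar> \<le> r"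
  shows "\<bar>f t - g t\<bar> \<le> r"
proof -
  obtain p \<eta> where p: "\<And>d. d \<in> D \<Longrightarrow> p d \<in> D" "\<And>d. d \<in> D \<Longrightarrow> \<eta> d = 1 \<or> \<eta> d = (-1::real)"
    "\<And>d u. d \<in> D \<Longrightarrow> u \<in> sign_functions \<Longrightarrow> G u (p d) = \<eta> d * u d"
    "\<And>d u. d \<in> D \<Longrightarrow> u \<in> sign_functions \<Longrightarrow> G (u(d := - u d)) = (G u)(p d := - G u (p d))"
    by (rule G_on_signs) (rule that; blast)
  have surj: "D \<subseteq> p ` D"
    by (rule flip_point_surj) (use p(4)[of _ "\<lambda>_. 1"] in \<open>simp add: sign_functions_def\<close>)
  have formula: "G w (p d) = \<eta> d * w d" if w: "w \<in> unit_ball" and d: "d \<in> D" for w d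
  proof (rule ccontr)
    assume ne: "G w (p d) \<noteq> \<eta> d * w d"
    define k where "k = \<bar>G w (p d) - \<eta> d * w d\<bar> / 3"
    have k: "0 < k" using ne by (simp add: k_def)
    obtain \<delta> where \<delta>: "0 < \<delta>" "\<And>g t. g \<in> unit_ball \<Longrightarrow> (\<And>t. \<bar>w t - g t\<bar> \<le> \<delta>) \<Longrightarrow> \<bar>G w t - G g t\<bar> \<le> k"
      using G_continuous[OF w k] by auto
    define e where "e = min (min \<delta> k) 1 / 2"
    have e: "0 < e" "e \<le> 1" "2 * e \<le> \<delta>" "2 * e \<le> k" using \<delta>(1) k by (auto simp: e_def)
    obtain v where v: "continuous_on UNIV v" "finite (range v)" "range v \<subseteq> range w" "\<And>t. \<bar>v t - w t\<bar> \<le> e"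
      by (rule finite_range_approx[OF unit_ballD(1)[OF w] e(1)]) (rule that; blast)
    have v1: "\<bar>v t\<bar> \<le> 1" for t
    proof -
      have "v t \<in> range w" using v(3) by auto
      then show ?thesis using unit_ballD(2)[OF w] by auto
    qed
    define u where "u = (\<lambda>t. if 0 \<le> v t then 1 else (-1::real))"
    \<comment> \<open>Cutting the modulus off below at \<open>e\<close> makes \<open>h\<close>
      strictly positive, even at zeros of \<open>v\<close>. It moves \<open>v\<close> by at most
      another \<open>e\<close>, hence the \<open>2 * e\<close> below.\<close>
    define h where "h = (\<lambda>t. max \<bar>v t\<bar> e)"
    have u: "u \<in> sign_functions" unfolding sign_functions_def
      using continuous_on_comp_finite_range[OF v(1,2), of "\<lambda>a. if 0 \<le> a then 1 else (-1::real)"]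
      by (simp add: u_def)
    have hpos: "0 < h t" for t using e by (simp add: h_def less_max_iff_disj)
    have hb: "h \<in> unit_ball"
    proof (rule unit_ballI)
      show "continuous_on UNIV h" unfolding h_def by (intro continuous_intros v)
      show "\<bar>h t\<bar> \<le> 1" for t using v1[of t] e by (simp add: h_def)
    qed
    have "range h = (\<lambda>a. max \<bar>a\<bar> e) ` range v" by (auto simp: h_def)
    then have hfin: "finite (range h)" using v(2) by simp
    have uh: "(\<lambda>t. u t * h t) \<in> unit_ball" by (intro unit_ball_mult sign_functions_subset u hb)
    have near: "\<bar>w t - u t * h t\<bar> \<le> 2 * e" for t
      using v(4)[of t] e by (auto simp: u_def h_def max_def)
    interpret N: normalized_nonexpansive_homeo "\<lambda>f t. u t * F (\<lambda>s. G u s * f s) t"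
      "\<lambda>f t. G u t * G (\<lambda>s. u s * f s) t" p
      using conjugate_normalized[OF u surj p(4)[OF _ u]] .
    have "G u (p d) * G (\<lambda>s. u s * h s) (p d) = h d"
      by (rule N.G_finite_range[OF hb hfin hpos d])
    \<comment> \<open>The factor \<open>G u (p d)\<close> is \<open>\<eta> d * u d\<close>, which is
      its own inverse.\<close>
    then have "G (\<lambda>s. u s * h s) (p d) = \<eta> d * (u d * h d)"
      using p(2)[OF d] sign_functionsD[OF u, of d] by (auto simp: p(3)[OF d u])
    moreover have "\<bar>G w (p d) - G (\<lambda>s. u s * h s) (p d)\<bar> \<le> k"
      using near e(3) by (intro \<delta>(2) uh) (meson order_trans)
    ultimately have "\<bar>G w (p d) - \<eta> d * w d\<bar> \<le> 2 * k"
      using near[of d] e(4) p(2)[OF d] by auto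
    then show False using k by (simp add: k_def)
  qed
  have "\<bar>f q - g q\<bar> \<le> r" if q: "q \<in> D" for q
  proof -
    obtain d where d: "d \<in> D" "q = p d" using q surj by blast
    have "f q = \<eta> d * F f d" "g q = \<eta> d * F g d"
      using formula[OF F_ball[OF f] d(1)] formula[OF F_ball[OF g] d(1)] by (simp_all add: GF f g d)
    then show ?thesis using r[of d] p(2)[OF d(1)] by auto
  qed
  moreover have "continuous_on UNIV (\<lambda>t. \<bar>f t - g t\<bar>)"
    by (intro continuous_intros unit_ballD(1) f g)
  ultimately show ?thesis
    by (rule dense_imp_le[OF dense_isolated, of "\<lambda>t. \<bar>f t - g t\<bar>", rotated])
qed

end

section \<open>Transfer to the Banach space of bounded continuous functions\<close>

theorem theorem1p2:
  fixes F :: "('a::t2_space \<Rightarrow>\<^sub>C real) \<Rightarrow> ('a \<Rightarrow>\<^sub>C real)"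
  assumes "compact (UNIV :: 'a set)"
    and "zero_dimensional (euclidean :: 'a topology)"
    and "closure {x::'a. x isolated_in UNIV} = UNIV"
    and "\<exists>G. homeomorphism (cball 0 1) (cball 0 1) F G"
    and "\<forall>f\<in>cball 0 1. \<forall>g\<in>cball 0 1. dist (F f) (F g) \<le> dist f g"
  shows "\<forall>f\<in>cball 0 1. \<forall>g\<in>cball 0 1. dist (F f) (F g) = dist f g"
proof -
  obtain G where G: "homeomorphism (cball 0 1) (cball 0 1) F G" using assms(4) by blast
  have F_cball: "F f \<in> cball 0 1" and G_cball: "G f \<in> cball 0 1"
    and GF: "G (F f) = f" and FG: "F (G f) = f" if "f \<in> cball 0 1" for f
    using that homeomorphism_image1[OF G] homeomorphism_image2[OF G]
      homeomorphism_apply1[OF G] homeomorphism_apply2[OF G] by blast+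
  have ball_iff: "apply_bcontfun f \<in> unit_ball \<longleftrightarrow> f \<in> cball 0 1" for f :: "'a \<Rightarrow>\<^sub>C real"
  proof
    assume "apply_bcontfun f \<in> unit_ball"
    then have "dist f 0 \<le> 1" by (intro dist_bound) (simp add: unit_ball_def)
    then show "f \<in> cball 0 1" by (simp add: dist_commute)
  next
    assume "f \<in> cball 0 1"
    then have "dist (f t) ((0::'a \<Rightarrow>\<^sub>C real) t) \<le> 1" for t
      using dist_bounded[of f t 0] by (simp add: dist_commute)
    then show "apply_bcontfun f \<in> unit_ball" by (intro unit_ballI) auto
  qed
  have inv: "apply_bcontfun (Bcontfun f) = f" if "f \<in> unit_ball" for f :: "'a \<Rightarrow> real"
  proof -
    have "bounded (range f)" using unit_ballD(2)[OF that] by (auto simp: bounded_iff)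
    then show ?thesis
      using unit_ballD(1)[OF that] by (intro Bcontfun_inverse) (simp add: bcontfun_def)
  qed
  have cball: "Bcontfun f \<in> cball 0 1" if "f \<in> unit_ball" for f :: "'a \<Rightarrow> real"
    using ball_iff[of "Bcontfun f"] that inv by simp
  have isolated: "x isolated_in UNIV \<longleftrightarrow> open {x}" for x :: 'a
    by (auto simp: isolated_in_def)
  \<comment> \<open>\<open>Bcontfun\<close> is inverted by \<open>apply_bcontfun\<close> on
    \<open>unit_ball\<close> by \<open>inv\<close>, which suffices because the locale constrains the
    maps only there.\<close>
  define F' where "F' = (\<lambda>f. apply_bcontfun (F (Bcontfun f)))"
  define G' where "G' = (\<lambda>f. apply_bcontfun (G (Bcontfun f)))"
  interpret nonexpansive_homeo F' G'
  proof
    show "compact (UNIV :: 'a set)" by fact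
    show "\<exists>V. open V \<and> closed V \<and> x \<in> V \<and> V \<subseteq> U" if "open U" "x \<in> U" for U and x :: 'a
      using assms(2) that by (auto simp: zero_dimensional_def)
    show "closure {d::'a. open {d}} = UNIV" using assms(3) by (simp add: isolated)
    fix f :: "'a \<Rightarrow> real" assume f: "f \<in> unit_ball"
    show "F' f \<in> unit_ball" "G' f \<in> unit_ball"
      unfolding F'_def G'_def ball_iff by (intro F_cball G_cball cball f)+
    show "G' (F' f) = f" "F' (G' f) = f"
      using GF[OF cball[OF f]] FG[OF cball[OF f]] inv[OF f]
      by (simp_all add: F'_def G'_def apply_bcontfun_inverse)
    show "\<bar>F' f t - F' g t\<bar> \<le> r" if g: "g \<in> unit_ball" and r: "\<And>t. \<bar>f t - g t\<bar> \<le> r" for g r t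
    proof -
      have "\<bar>F' f t - F' g t\<bar> \<le> dist (F (Bcontfun f)) (F (Bcontfun g))"
        unfolding F'_def dist_real_def[symmetric] by (rule dist_bounded)
      also have "\<dots> \<le> dist (Bcontfun f) (Bcontfun g)" using assms(5) cball f g by blast
      also have "\<dots> \<le> r" using r by (intro dist_bound) (simp add: inv f g dist_real_def)
      finally show ?thesis .
    qed
    show "\<exists>\<delta>>0. \<forall>g\<in>unit_ball. (\<forall>t. \<bar>f t - g t\<bar> \<le> \<delta>) \<longrightarrow> (\<forall>t. \<bar>G' f t - G' g t\<bar> \<le> e)"
      if e: "0 < e" for e
    proof -
      have "continuous_on (cball 0 1) G" by (rule homeomorphism_cont2[OF G])
      then obtain \<delta> where \<delta>: "0 < \<delta>"
        "\<And>g. g \<in> cball 0 1 \<Longrightarrow> dist g (Bcontfun f) < \<delta> \<Longrightarrow> dist (G g) (G (Bcontfun f)) < e"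
        using cball[OF f] e unfolding continuous_on_iff by blast
      \<comment> \<open>Halving \<open>\<delta>\<close> turns a non-strict pointwise bound into the
        strict distance bound that continuity asks for.\<close>
      have "\<bar>G' f t - G' g t\<bar> \<le> e" if g: "g \<in> unit_ball" "\<forall>t. \<bar>f t - g t\<bar> \<le> \<delta> / 2" for g t
      proof -
        have "dist (Bcontfun g) (Bcontfun f) \<le> \<delta> / 2"
          using g(2) by (intro dist_bound) (simp add: inv f g(1) dist_real_def abs_minus_commute)
        then have "dist (G (Bcontfun g)) (G (Bcontfun f)) < e"
          using \<delta>(1) by (intro \<delta>(2) cball g(1)) simp
        moreover have "\<bar>G' f t - G' g t\<bar> \<le> dist (G (Bcontfun f)) (G (Bcontfun g))"
          unfolding G'_def dist_real_def[symmetric] by (rule dist_bounded)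
        ultimately show ?thesis by (simp add: dist_commute)
      qed
      then show ?thesis using \<delta>(1) by (intro exI[of _ "\<delta> / 2"]) auto
    qed
  qed
  show ?thesis
  proof (intro ballI antisym)
    fix f g :: "'a \<Rightarrow>\<^sub>C real" assume fg: "f \<in> cball 0 1" "g \<in> cball 0 1"
    show "dist (F f) (F g) \<le> dist f g" using assms(5) fg by blast
    \<comment> \<open>For the reverse inequality, the distance of the images serves as the bound
      \<open>r\<close> in \<open>F_isometry\<close>.\<close>
    have "\<bar>F' f t - F' g t\<bar> \<le> dist (F f) (F g)" for t
      unfolding F'_def apply_bcontfun_inverse dist_real_def[symmetric] by (rule dist_bounded)
    then have "\<bar>f t - g t\<bar> \<le> dist (F f) (F g)" for t
      using F_isometry[of f g "dist (F f) (F g)" t] fg by (simp only: ball_iff)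
    then show "dist f g \<le> dist (F f) (F g)" by (intro dist_bound) (simp add: dist_real_def)
  qed
qed

end
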